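(* Let $k\ge1$ and let $\{A_1,A_2\}$ be a $(k^2+1,2,k,1)$-SEDF in $\mathbb{Z}_{k^2+1}$ with $A_1=\{x_1,\ldots,x_k\}$ and $A_2=\{y_1,\ldots,y_k\}$, where (viewing elements as integers in $\{0,1,\ldots,k^2\}$) $x_i<y_j$ for all $1\le i,j\le k$. Let $a$ be a positive integer. Then $\{B_1,B_2\}$ is an $((ak)^2+1,2,ak,1)$-SEDF in $\mathbb{Z}_{(ak)^2+1}$, where $B_1=\bigcup_{i=1}^k\{a x_i+\alpha: 0\le\alpha\le a-1\}$ and $B_2=\bigcup_{i=1}^k\{a(y_i+k^2\beta): 0\le\beta\le a-1\}$, with the integers $x_i,y_i$ interpreted as the elements of $\mathbb{Z}_{(ak)^2+1}$ with these labels.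
   Context: Elements of $\mathbb{Z}_n$ are $\{0,1,\ldots,n-1\}$ with the natural integer ordering. For an additive group $G$ of order $n$, an $(n,m,k,\lambda)$-SEDF is a set of $m\ge2$ pairwise disjoint $k$-subsets $A_1,\ldots,A_m$ of $G$ such that for every $i$ the multiset $\{x-y: x\in A_i, y\in \bigcup_{j\neq i}A_j\}$ contains every non-zero element of $G$ exactly $\lambda$ times. *)

theory Defs
  imports "HOL-Algebra.Elementary_Groups" "HOL-Library.Multiset"
begin

(* G is written multiplicatively, following HOL-Algebra, so x \<otimes> inv y is the difference x - y
   of the additive notation.  Finiteness is explicit because order G = 0 for infinite G. *)

definition diff_mset :: "('a, 'b) monoid_scheme \<Rightarrow> 'a set \<Rightarrow> 'a set \<Rightarrow> 'a multiset" where
  "diff_mset G X Y = {# x \<otimes>\<^bsub>G\<^esub> inv\<^bsub>G\<^esub> y. (x, y) \<in># mset_set (X \<times> Y) #}"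

definition SEDF :: "('a, 'b) monoid_scheme \<Rightarrow> nat \<Rightarrow> nat \<Rightarrow> nat \<Rightarrow> nat \<Rightarrow> 'a set set \<Rightarrow> bool" where
  "SEDF G n m k l F \<longleftrightarrow>
     group G \<and> finite (carrier G) \<and> order G = n \<and>
     2 \<le> m \<and> finite F \<and> card F = m \<and> pairwise disjnt F \<and>
     (\<forall>A\<in>F. A \<subseteq> carrier G \<and> card A = k) \<and>
     (\<forall>A\<in>F. \<forall>d\<in>carrier G - {\<one>\<^bsub>G\<^esub>}. count (diff_mset G A (\<Union>(F - {A}))) d = l)"

end

theory Submission
  imports Defs
begin

text \<open>
  When every element of \<open>A\<close> lies below every element of \<open>B\<close>, no difference wraps around the
  modulus \<open>k\<^sup>2 + 1\<close>: the pair is an SEDF with \<open>\<lambda> = 1\<close> iff \<open>(x, y) \<mapsto> y - x\<close> is a bijection from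
  \<open>A \<times> B\<close> onto the integer interval from \<open>1\<close> to \<open>k\<^sup>2\<close>.  The differences of the blown-up sets are
  \<open>(a (y - x) - \<alpha>) + a k\<^sup>2 \<beta>\<close>.  By division with remainder \<open>a d - \<alpha>\<close> runs through the integers
  from \<open>1\<close> to \<open>a k\<^sup>2\<close>, and adding \<open>a k\<^sup>2 \<beta>\<close> extends this to all integers from \<open>1\<close> to \<open>(a k)\<^sup>2\<close>.
  Since there are at most \<open>(a k)\<^sup>2\<close> pairs, this surjection is a bijection.
\<close>

section \<open>Difference multisets in a cyclic group as fibre cardinalities\<close>

lemma count_diff_mset_integer_mod_group:
  fixes A B :: "int set"
  assumes "n > 0" "A \<subseteq> {0..<int n}" "B \<subseteq> {0..<int n}"
  shows "count (diff_mset (integer_mod_group n) A B) d =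
    card {p \<in> A \<times> B. (fst p - snd p) mod int n = d}"
proof -
  have fin: "finite (A \<times> B)"
    using assms by (meson finite_SigmaI finite_atLeastLessThan_int finite_subset)
  have "diff_mset (integer_mod_group n) A B
      = image_mset (\<lambda>p. (fst p - snd p) mod int n) (mset_set (A \<times> B))"
    unfolding diff_mset_def
  proof (rule image_mset_cong)
    fix p assume "p \<in># mset_set (A \<times> B)"
    \<comment> \<open>Membership in the carrier is what identifies the group inverse of
      \<open>snd p\<close> with its negative modulo \<open>n\<close>.\<close>
    then have "snd p \<in> carrier (integer_mod_group n)"
      using fin assms by (auto simp: carrier_integer_mod_group)
    then show "(case p of (x, y) \<Rightarrow> x \<otimes>\<^bsub>integer_mod_group n\<^esub> inv\<^bsub>integer_mod_group n\<^esub> y)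
        = (fst p - snd p) mod int n"
      by (simp add: case_prod_beta mod_add_right_eq)
  qed
  then show ?thesis
    using fin by (auto simp: count_image_mset' intro!: arg_cong[of _ _ card])
qed

section \<open>Ordered pairs: from group differences to a bijection of integers\<close>

lemma card_eq_1_iff_Ex1: "card {x. P x} = 1 \<longleftrightarrow> (\<exists>!x. P x)"
  by (auto simp: card_1_singleton_iff set_eq_iff)

lemma bij_betw_iff_Ex1:
  "bij_betw f S T \<longleftrightarrow> f ` S \<subseteq> T \<and> (\<forall>t\<in>T. \<exists>!s. s \<in> S \<and> f s = t)"
proof
  assume "bij_betw f S T"
  then have "inj_on f S" "f ` S = T" by (auto simp: bij_betw_def)
  then show "f ` S \<subseteq> T \<and> (\<forall>t\<in>T. \<exists>!s. s \<in> S \<and> f s = t)"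
    unfolding inj_on_def by (metis imageE order_refl)
next
  assume *: "f ` S \<subseteq> T \<and> (\<forall>t\<in>T. \<exists>!s. s \<in> S \<and> f s = t)"
  show "bij_betw f S T"
  proof (rule bij_betw_imageI)
    show "inj_on f S"
      using * by (intro inj_onI) (metis image_subset_iff)
    have "T \<subseteq> f ` S"
      using * by (metis imageI subsetI)
    then show "f ` S = T"
      using * by (simp add: subset_antisym)
  qed
qed

text \<open>The differences from \<open>B\<close> to \<open>A\<close> are their own residues, while
  those from \<open>A\<close> to \<open>B\<close> are the reflections d \<mapsto> k^2 + 1 - d of
  them, so the two SEDF conditions coincide. The equivalence is read forwards for the given pair and
  backwards for the blown-up one.\<close>

lemma SEDF_pair_iff_bij_betw:
  fixes A B :: "int set"
  assumes k: "k \<ge> 1"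
    and A: "A \<subseteq> {0..int (k^2)}" "card A = k"
    and B: "B \<subseteq> {0..int (k^2)}" "card B = k"
    and less: "\<And>x y. x \<in> A \<Longrightarrow> y \<in> B \<Longrightarrow> x < y"
  shows "SEDF (integer_mod_group (k^2 + 1)) (k^2 + 1) 2 k 1 {A, B} \<longleftrightarrow>
    bij_betw (\<lambda>(x, y). y - x) (A \<times> B) {1..int (k^2)}"
proof -
  define N where "N = k^2"
  define D where "D = (\<lambda>e. {p \<in> A \<times> B. snd p - fst p = e})"
  have N: "A \<subseteq> {0..<int (N + 1)}" "B \<subseteq> {0..<int (N + 1)}"
    using A B by (auto simp: N_def)
  have disj: "A \<inter> B = {}" using less by blast
  have "A \<noteq> {}" using A k by auto
  \<comment> \<open>Disjointness alone would allow both sets to be empty, and then the family would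
    have only one member; k \<ge> 1 excludes this.\<close>
  then have ne: "A \<noteq> B" using disj by blast
  have range: "snd p - fst p \<in> {1..int N}" if "p \<in> A \<times> B" for p
  proof -
    have "fst p \<ge> 0" "snd p < int N + 1" "fst p < snd p"
      using that N less by (auto dest!: subsetD)
    then show ?thesis by simp
  qed
  have BA: "count (diff_mset (integer_mod_group (N + 1)) B A) d = card (D d)"
    if "d \<in> {1..int N}" for d
  proof -
    have "(snd p - fst p) mod int (N + 1) = snd p - fst p" if "p \<in> A \<times> B" for p
      using range[OF that] by (intro mod_pos_pos_trivial) auto
    then have "{p \<in> B \<times> A. (fst p - snd p) mod int (N + 1) = d} = prod.swap ` D d"
      by (force simp: D_def image_iff)
    then show ?thesis
      using count_diff_mset_integer_mod_group[of "N + 1" B A d] N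
      by (simp add: card_image)
  qed
  have AB: "count (diff_mset (integer_mod_group (N + 1)) A B) d = card (D (int N + 1 - d))"
    if "d \<in> {1..int N}" for d
  proof -
    have "(fst p - snd p) mod int (N + 1) = int N + 1 - (snd p - fst p)" if "p \<in> A \<times> B" for p
    proof -
      \<comment> \<open>The difference lies between -N and -1, so adding the modulus once yields its
        residue.\<close>
      have "(fst p - snd p) mod int (N + 1) = (fst p - snd p + int (N + 1)) mod int (N + 1)"
        by (rule mod_add_self2[symmetric])
      also have "\<dots> = fst p - snd p + int (N + 1)"
        using range[OF that] by (intro mod_pos_pos_trivial) auto
      finally show ?thesis by simp
    qed
    then have "{p \<in> A \<times> B. (fst p - snd p) mod int (N + 1) = d} = D (int N + 1 - d)"
      unfolding D_def by force
    then show ?thesis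
      using count_diff_mset_integer_mod_group[of "N + 1" A B d] N by simp
  qed
  have carrier: "carrier (integer_mod_group (N + 1)) - {0} = {1..int N}"
    by (auto simp: carrier_integer_mod_group)
  have union: "\<Union>({A, B} - {A}) = B" "\<Union>({A, B} - {B}) = A"
    using ne by auto
  have "SEDF (integer_mod_group (N + 1)) (N + 1) 2 k 1 {A, B} \<longleftrightarrow>
      (\<forall>d\<in>{1..int N}. card (D (int N + 1 - d)) = 1) \<and> (\<forall>d\<in>{1..int N}. card (D d) = 1)"
  proof -
    have "group (integer_mod_group (N + 1))" "finite (carrier (integer_mod_group (N + 1)))"
      "order (integer_mod_group (N + 1)) = N + 1" "card {A, B} = 2" "pairwise disjnt {A, B}"
      "\<forall>X\<in>{A, B}. X \<subseteq> carrier (integer_mod_group (N + 1)) \<and> card X = k"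
      using ne disj N A(2) B(2)
      by (auto simp: carrier_integer_mod_group order_def pairwise_def disjnt_def)
    then have "SEDF (integer_mod_group (N + 1)) (N + 1) 2 k 1 {A, B} \<longleftrightarrow>
      (\<forall>X\<in>{A, B}. \<forall>d\<in>{1..int N}.
        count (diff_mset (integer_mod_group (N + 1)) X (\<Union>({A, B} - {X}))) d = 1)"
      unfolding SEDF_def one_integer_mod_group carrier by simp
    then show ?thesis
      unfolding ball_simps union using AB BA by simp
  qed
  also have "\<dots> \<longleftrightarrow> (\<forall>d\<in>{1..int N}. card (D d) = 1)"
  proof -
    \<comment> \<open>The reflection maps the interval into itself, so the first conjunct is an
      instance of the second.\<close>
    have "int N + 1 - d \<in> {1..int N}" if "d \<in> {1..int N}" for d using that by auto
    then show ?thesis by blast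
  qed
  also have "\<dots> \<longleftrightarrow> bij_betw (\<lambda>(x, y). y - x) (A \<times> B) {1..int N}"
  proof -
    have img: "(\<lambda>(x, y). y - x) ` (A \<times> B) \<subseteq> {1..int N}"
      using range by fastforce
    have "card (D d) = 1 \<longleftrightarrow> (\<exists>!p. p \<in> A \<times> B \<and> (case p of (x, y) \<Rightarrow> y - x) = d)" for d
      unfolding D_def card_eq_1_iff_Ex1 by (simp add: case_prod_beta)
    then show ?thesis
      by (simp only: bij_betw_iff_Ex1 img simp_thms)
  qed
  finally show ?thesis by (simp add: N_def)
qed

section \<open>Blowing up the two sets\<close>

lemma mult_minus_remainder_exists:
  fixes a e :: int
  assumes "a > 0"
  obtains d r where "e = a * d - r" "0 \<le> r" "r \<le> a - 1"
proof
  \<comment> \<open>The witness for \<open>d\<close> is the ceiling of e/a: rounding up makes the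
    remainder a subtracted term, as the offset \<alpha> is in a (y - x) - \<alpha>.\<close>
  show "e = a * (- ((- e) div a)) - (- e) mod a"
    using mult_div_mod_eq[of a "- e"] unfolding mult_minus_right by linarith
qed (use assms in auto)

text \<open>Injectivity of the parametrisations of \<open>A'\<close> and \<open>B'\<close> is not
  checked directly. Each set has at most a k elements as an image, and surjectivity of the
  difference map forces equality.\<close>

lemma blow_up_bij_betw:
  fixes A B :: "int set" and a k :: nat
  assumes a: "a > 0"
    and A: "A \<subseteq> {0..int (k^2)}" "card A = k"
    and B: "B \<subseteq> {0..int (k^2)}" "card B = k"
    and less: "\<And>x y. x \<in> A \<Longrightarrow> y \<in> B \<Longrightarrow> x < y"
    and bij: "bij_betw (\<lambda>(x, y). y - x) (A \<times> B) {1..int (k^2)}"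
  defines "A' \<equiv> (\<lambda>(x, \<alpha>). int a * x + \<alpha>) ` (A \<times> {0..int a - 1})"
    and "B' \<equiv> (\<lambda>(y, \<beta>). int a * (y + int (k^2) * \<beta>)) ` (B \<times> {0..int a - 1})"
  shows "A' \<subseteq> {0..int ((a * k)^2)}" and "B' \<subseteq> {0..int ((a * k)^2)}"
    and "bij_betw (\<lambda>(x, y). y - x) (A' \<times> B') {1..int ((a * k)^2)}"
    and "card A' = a * k" and "card B' = a * k"
proof -
  let ?f = "\<lambda>(x :: int, y). y - x"
  have fin: "finite A" "finite B"
    using A B by (meson finite_atLeastAtMost_int finite_subset)+
  then have fin': "finite A'" "finite B'"
    by (auto simp: A'_def B'_def)
  have leA: "card A' \<le> a * k"
    using card_image_le[of "A \<times> {0..int a - 1}"] fin A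
    by (simp add: A'_def card_cartesian_product mult.commute)
  have leB: "card B' \<le> a * k"
    using card_image_le[of "B \<times> {0..int a - 1}"] fin B
    by (simp add: B'_def card_cartesian_product mult.commute)
  have sq: "int ((a * k)^2) = int a * (int a * int (k^2))"
    by (simp add: power2_eq_square algebra_simps)
  have diff: "1 \<le> v - u \<and> 0 \<le> u \<and> v \<le> int ((a * k)^2)" if uv: "u \<in> A'" "v \<in> B'" for u v
  proof -
    obtain x \<alpha> y \<beta> where u: "u = int a * x + \<alpha>" "x \<in> A" "0 \<le> \<alpha>" "\<alpha> \<le> int a - 1"
      and v: "v = int a * (y + int (k^2) * \<beta>)" "y \<in> B" "0 \<le> \<beta>" "\<beta> \<le> int a - 1"
      using uv by (auto simp: A'_def B'_def)
    \<comment> \<open>Integers x < y differ by at least 1; after scaling, the gap of at least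
      \<open>a\<close> exceeds the offset \<alpha> \<le> a - 1.\<close>
    have "int a * (x + 1) \<le> int a * y"
      using less[OF u(2) v(2)] by (intro mult_left_mono) auto
    moreover have "0 \<le> int a * (int (k^2) * \<beta>)"
      using v by simp
    ultimately have "1 \<le> v - u"
      using u(1,4) v(1) unfolding distrib_left by linarith
    moreover have "y + int (k^2) * \<beta> \<le> int (k^2) + int (k^2) * (int a - 1)"
      using v B by (intro add_mono mult_left_mono) auto
    then have "y + int (k^2) * \<beta> \<le> int a * int (k^2)"
      by (simp add: algebra_simps)
    then have "v \<le> int ((a * k)^2)"
      unfolding v sq by (intro mult_left_mono) auto
    moreover have "0 \<le> u"
      using u A by auto
    ultimately show ?thesis by simp
  qed
  then have sub: "?f ` (A' \<times> B') \<subseteq> {1..int ((a * k)^2)}"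
    by fastforce
  have sup: "{1..int ((a * k)^2)} \<subseteq> ?f ` (A' \<times> B')"
  proof
    fix e assume e: "e \<in> {1..int ((a * k)^2)}"
    have "k \<noteq> 0" using e by (intro notI) simp
    then have K: "int (k^2) > 0" by simp
    obtain d r where dr: "e = int a * d - r" "0 \<le> r" "r \<le> int a - 1"
      using mult_minus_remainder_exists[of "int a" e] a by auto
    have "0 < int a * d" using dr e by simp
    then have d1: "1 \<le> d" using a by (simp add: zero_less_mult_iff)
    \<comment> \<open>Here a d = e + r, with e \<le> (a k)^2 and r \<le> a - 1.\<close>
    have "int a * d < int a * (int a * int (k^2) + 1)"
      using dr e unfolding sq by (simp add: algebra_simps)
    then have d2: "d \<le> int a * int (k^2)"
      using a by (simp add: mult_less_cancel_left)
    \<comment> \<open>Dividing d - 1 instead of d puts \<open>g\<close> in the interval from 1 to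
      k^2, exactly the range of the differences y - x, rather than from 0 to k^2 - 1.\<close>
    define \<beta> where "\<beta> = (d - 1) div int (k^2)"
    define g where "g = (d - 1) mod int (k^2) + 1"
    have d: "d = g + int (k^2) * \<beta>"
      using mult_div_mod_eq[of "int (k^2)" "d - 1"] unfolding \<beta>_def g_def by linarith
    have g: "g \<in> {1..int (k^2)}"
      using pos_mod_sign[OF K, of "d - 1"] pos_mod_bound[OF K, of "d - 1"] by (simp add: g_def)
    then have "g \<in> ?f ` (A \<times> B)"
      using bij by (simp only: bij_betw_imp_surj_on)
    then obtain x y where xy: "x \<in> A" "y \<in> B" "y - x = g"
      by auto
    have "0 \<le> \<beta>"
      using d1 K by (simp add: \<beta>_def pos_imp_zdiv_nonneg_iff)
    moreover have "\<beta> < int a"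
    proof -
      have "int (k^2) * \<beta> < int (k^2) * int a"
        using d d2 g by (simp add: mult.commute)
      then show ?thesis using K by (simp add: mult_less_cancel_left)
    qed
    ultimately have "int a * x + r \<in> A'" "int a * (y + int (k^2) * \<beta>) \<in> B'"
      using xy dr by (auto simp: A'_def B'_def)
    moreover have "e = int a * (y + int (k^2) * \<beta>) - (int a * x + r)"
      unfolding dr(1) d xy(3)[symmetric] by (simp add: algebra_simps)
    ultimately show "e \<in> ?f ` (A' \<times> B')"
      by (force simp: image_iff)
  qed
  have img: "?f ` (A' \<times> B') = {1..int ((a * k)^2)}"
    using sub sup by blast
  have card_img: "(a * k)^2 = card (?f ` (A' \<times> B'))"
    unfolding img card_atLeastAtMost_int by (simp only: add_diff_cancel_right' nat_int)
  also have "\<dots> \<le> card (A' \<times> B')"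
    using fin' by (intro card_image_le) simp
  finally have le: "(a * k)^2 \<le> card A' * card B'"
    by (simp add: card_cartesian_product)
  have cards: "card A' = a * k \<and> card B' = a * k"
  proof (cases "a * k = 0")
    case True
    then show ?thesis using leA leB by (simp only: le_zero_eq)
  next
    case False
    \<comment> \<open>Bounding one factor of the product at a time by a k and cancelling a k bounds
      the other from below.\<close>
    have "(a * k) * (a * k) \<le> card A' * (a * k)" "(a * k) * (a * k) \<le> (a * k) * card B'"
      using le mult_le_mono2[OF leB, of "card A'"] mult_le_mono1[OF leA, of "card B'"]
      unfolding power2_eq_square by linarith+
    then show ?thesis
      using leA leB False by (metis le_antisym mult_le_cancel1 mult_le_cancel2 neq0_conv)
  qed
  then show cA: "card A' = a * k" and cB: "card B' = a * k"
    by blast+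
  have "inj_on ?f (A' \<times> B')"
    using fin' cA cB card_img
    by (intro eq_card_imp_inj_on) (simp_all add: card_cartesian_product power2_eq_square)
  then show "bij_betw ?f (A' \<times> B') {1..int ((a * k)^2)}"
    using img by (simp add: bij_betw_def)
  \<comment> \<open>The upper bound on an element of \<open>A'\<close> and the lower bound on one of
    \<open>B'\<close> come from comparison with an element of the other set, so neither set may be
    empty alone.\<close>
  have "A \<noteq> {} \<longleftrightarrow> B \<noteq> {}"
    using A B fin by auto
  then have "A' \<noteq> {} \<longleftrightarrow> B' \<noteq> {}"
    using a by (simp add: A'_def B'_def)
  then show "A' \<subseteq> {0..int ((a * k)^2)}" "B' \<subseteq> {0..int ((a * k)^2)}"
    using diff by fastforce+
qed

section \<open>Transfer of the blown-up pair back to the cyclic group\<close>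

theorem theorem5p3:
  fixes k a :: nat
    and x y :: "nat \<Rightarrow> int"
    and A1 A2 B1 B2 :: "int set"
  assumes "k \<ge> 1"
    and "SEDF (integer_mod_group (k^2 + 1)) (k^2 + 1) 2 k 1 {A1, A2}"
    and "A1 = x ` {1..k}"
    and "A2 = y ` {1..k}"
    and "\<forall>i\<in>{1..k}. \<forall>j\<in>{1..k}. x i < y j"
    and "a > 0"
    and "B1 = (\<Union>i\<in>{1..k}. {(int a * x i + \<alpha>) mod (int ((a*k)^2 + 1)) | \<alpha>.
                 0 \<le> \<alpha> \<and> \<alpha> \<le> int a - 1})"
    and "B2 = (\<Union>i\<in>{1..k}. {(int a * (y i + int (k^2) * \<beta>)) mod (int ((a*k)^2 + 1)) | \<beta>.
                 0 \<le> \<beta> \<and> \<beta> \<le> int a - 1})"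
  shows "SEDF (integer_mod_group ((a*k)^2 + 1)) ((a*k)^2 + 1) 2 (a*k) 1 {B1, B2}"
proof -
  note k = assms(1) and sedf = assms(2) and a = \<open>a > 0\<close>
  have less: "\<And>u v. u \<in> A1 \<Longrightarrow> v \<in> A2 \<Longrightarrow> u < v"
    using assms(3-5) by auto
  have "A \<subseteq> carrier (integer_mod_group (k^2 + 1)) \<and> card A = k" if "A \<in> {A1, A2}" for A
    using sedf that unfolding SEDF_def by blast
  then have A: "A1 \<subseteq> {0..int (k^2)}" "card A1 = k" "A2 \<subseteq> {0..int (k^2)}" "card A2 = k"
    by (force simp: carrier_integer_mod_group)+
  have bij: "bij_betw (\<lambda>(x, y). y - x) (A1 \<times> A2) {1..int (k^2)}"
    using sedf SEDF_pair_iff_bij_betw[OF k A less] by simp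
  let ?B1 = "(\<lambda>(x, \<alpha>). int a * x + \<alpha>) ` (A1 \<times> {0..int a - 1})"
  let ?B2 = "(\<lambda>(y, \<beta>). int a * (y + int (k^2) * \<beta>)) ` (A2 \<times> {0..int a - 1})"
  have sub: "?B1 \<subseteq> {0..int ((a * k)^2)}" "?B2 \<subseteq> {0..int ((a * k)^2)}"
    and bij': "bij_betw (\<lambda>(x, y). y - x) (?B1 \<times> ?B2) {1..int ((a * k)^2)}"
    and card: "card ?B1 = a * k" "card ?B2 = a * k"
    using blow_up_bij_betw[OF a A less bij] by blast+
  \<comment> \<open>All differences are at least 1, which restores the order hypothesis for the new
    pair.\<close>
  have less': "u < v" if "u \<in> ?B1" "v \<in> ?B2" for u v
    using bij_betwE[OF bij', rule_format, of "(u, v)"] that by simp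
  \<comment> \<open>The labels are already reduced representatives, so the \<open>mod\<close> in the
    descriptions of \<open>B1\<close> and \<open>B2\<close> changes nothing.\<close>
  have mod: "(\<lambda>u. u mod int ((a * k)^2 + 1)) ` X = X" if "X \<subseteq> {0..int ((a * k)^2)}" for X
  proof -
    have "u mod int ((a * k)^2 + 1) = u" if "u \<in> X" for u
      using \<open>X \<subseteq> _\<close> that by (intro mod_pos_pos_trivial) auto
    then show ?thesis by simp
  qed
  have set_image: "{f \<alpha> |\<alpha>. 0 \<le> \<alpha> \<and> \<alpha> \<le> int a - 1} = f ` {0..int a - 1}" for f :: "int \<Rightarrow> int"
    by (auto simp: image_iff)
  have "B1 = (\<lambda>u. u mod int ((a * k)^2 + 1)) ` ?B1"
    unfolding assms(3,7) set_image by (simp only: Sigma_def image_UN image_image UNION_singleton_eq_range UN_simps case_prod_conv)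
  also have "\<dots> = ?B1" by (rule mod[OF sub(1)])
  finally have B1: "B1 = ?B1" .
  have "B2 = (\<lambda>u. u mod int ((a * k)^2 + 1)) ` ?B2"
    unfolding assms(4,8) set_image by (simp only: Sigma_def image_UN image_image UNION_singleton_eq_range UN_simps case_prod_conv)
  also have "\<dots> = ?B2" by (rule mod[OF sub(2)])
  finally have B2: "B2 = ?B2" .
  have "1 \<le> a * k" using a k by simp
  from SEDF_pair_iff_bij_betw[OF this sub(1) card(1) sub(2) card(2) less'] show ?thesis
    unfolding B1 B2 using bij' by blast
qed

end
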